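(* Let $r\in\mathbb{Z}_+$, $n\in\mathbb{Z}_+$, $x\in\mathbb{Z}_p$, and let $f\in\mathbb{N}$ with $(f,p)=1$. Then $$\beta_{n,q}^{(r)}(x)=\frac{1}{(1-q)^n}\sum_{l=0}^n\ \sum_{a_1,\dots,a_r=0}^{f-1}\binom nl(-1)^l q^{l(a_1+\cdots+a_r+x)}\left(\frac{l}{[lf]_q}\right)^r$$ and $$\beta_{n,q}^{(r)}(x)=[f]_q^{\,n-r}\sum_{a_1,\dots,a_r=0}^{f-1}\beta_{n,q^f}^{(r)}\left(\frac{a_1+\cdots+a_r+x}{f}\right).$$
   Context: $p$ is a fixed prime, $\mathbb{N}=\{1,2,\dots\}$, $\mathbb{Z}_+=\mathbb{N}\cup\{0\}$, and $\mathbb{C}_p$ is the completion of an algebraic closure of $\mathbb{Q}_p$, with $|p|_p=p^{-1}$. $q\in\mathbb{C}_p$ satisfies $|1-q|_p<1$ and is not a root of unity. For $x\in\mathbb{Z}_p$, $q^x=\sum_{k\ge0}\binom xk(q-1)^k$ and $[x]_q=\frac{1-q^x}{1-q}$; $0^0=1$. The $p$-adic $q$-integral of $g:\mathbb{Z}_p\to\mathbb{C}_p$ is $\int_{\mathbb{Z}_p}g(x)\,d\mu_q(x)=\lim_{N\to\infty}\frac{1}{[p^N]_q}\sum_{x=0}^{p^N-1}g(x)q^x$ (when the limit exists); multiple integrals are iterated. For $r\in\mathbb{N}$, the $q$-Bernoulli polynomials of order $r$ are $$\beta_{n,q}^{(r)}(x)=\int_{\mathbb{Z}_p}\cdots\int_{\mathbb{Z}_p}q^{-(x_1+\cdots+x_r)}[x+x_1+\cdots+x_r]_q^n\,d\mu_q(x_1)\cdots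 d\mu_q(x_r)\quad(r\text{ integrals}),$$ and for $r=0$ (no integrals, empty sum of variables) $\beta_{n,q}^{(0)}(x)=[x]_q^n$; for $r=0$ the sum over $a_1,\dots,a_r$ has a single term. $\beta_{n,q^f}^{(r)}$ is the same object with $q$ replaced by $q^f$. Convention: at $l=0$ the quotient $\frac{l}{[lf]_q}$ is read as its limiting value $\frac{q-1}{f\log q}$, where $\log$ is the $p$-adic logarithm. *)

theory Defs
  imports
    "HOL-Analysis.Analysis"
    "HOL-Computational_Algebra.Computational_Algebra"
begin

text \<open>
  The field of \<open>p\<close>-adic complex numbers is specified up to isometric isomorphism. In a complete
  field whose absolute value restricts to the \<open>p\<close>-adic one on the rationals, the topological
  closure of the rationals is the completion \<open>\<rat>\<^sub>p\<close>. The locale \<open>padic_complex\<close>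
  says that the elements algebraic over it form an algebraic closure of it, and that the whole
  (complete) field is the completion of that algebraic closure.
\<close>

definition padic_rats :: "'a::{field_char_0,complete_space} set" where
  "padic_rats = closure \<rat>"

definition padic_algebraic :: "'a::{field_char_0,complete_space} set" where
  "padic_algebraic =
     {z. \<exists>P. P \<noteq> 0 \<and> (\<forall>i. coeff P i \<in> padic_rats) \<and> poly P z = 0}"

locale padic_complex =
  fixes p :: nat
    and absp :: "'a::{field_char_0,complete_space} \<Rightarrow> real"
  assumes prime_p: "prime p"
    and absp_eq_0_iff: "absp x = 0 \<longleftrightarrow> x = 0"
    and absp_mult: "absp (x * y) = absp x * absp y"
    and absp_ultrametric: "absp (x + y) \<le> max (absp x) (absp y)"
    and absp_p: "absp (of_nat p) = 1 / real p"
    and dist_absp: "dist x y = absp (x - y)"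
    and padic_algebraic_closed:
      "(\<forall>i. coeff (P :: 'a poly) i \<in> padic_algebraic) \<Longrightarrow> degree P > 0 \<Longrightarrow>
         \<exists>z\<in>padic_algebraic. poly P z = 0"
    and padic_algebraic_dense: "closure padic_algebraic = (UNIV :: 'a set)"

definition padic_ints :: "('a::{field_char_0,complete_space} \<Rightarrow> real) \<Rightarrow> 'a set" where
  "padic_ints absp = {x \<in> padic_rats. absp x \<le> 1}"

definition qpow :: "'a::{field_char_0,complete_space} \<Rightarrow> 'a \<Rightarrow> 'a" where
  "qpow q x = (\<Sum>k. (x gchoose k) * (q - 1) ^ k)"

definition qbracket :: "'a::{field_char_0,complete_space} \<Rightarrow> 'a \<Rightarrow> 'a" where
  "qbracket q x = (1 - qpow q x) / (1 - q)"

definition padic_log :: "'a::{field_char_0,complete_space} \<Rightarrow> 'a" where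
  "padic_log z = (\<Sum>k. (-1) ^ k * (z - 1) ^ Suc k / of_nat (Suc k))"

definition q_riemann_sum ::
    "nat \<Rightarrow> 'a::{field_char_0,complete_space} \<Rightarrow> ('a \<Rightarrow> 'a) \<Rightarrow> nat \<Rightarrow> 'a" where
  "q_riemann_sum p q g N =
     1 / qbracket q (of_nat (p ^ N)) * (\<Sum>x<p ^ N. g (of_nat x) * qpow q (of_nat x))"

definition q_integrable ::
    "nat \<Rightarrow> 'a::{field_char_0,complete_space} \<Rightarrow> ('a \<Rightarrow> 'a) \<Rightarrow> bool" where
  "q_integrable p q g \<longleftrightarrow> convergent (q_riemann_sum p q g)"

definition q_integral ::
    "nat \<Rightarrow> 'a::{field_char_0,complete_space} \<Rightarrow> ('a \<Rightarrow> 'a) \<Rightarrow> 'a" where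
  "q_integral p q g = lim (q_riemann_sum p q g)"

text \<open>
  A function of \<open>r\<close> variables takes the list \<open>[x\<^sub>1, \<dots>, x\<^sub>r]\<close>; the
  innermost integration is over \<open>x\<^sub>1\<close>.
\<close>

primrec iter_q_integral ::
    "nat \<Rightarrow> 'a::{field_char_0,complete_space} \<Rightarrow> nat \<Rightarrow> ('a list \<Rightarrow> 'a) \<Rightarrow> 'a" where
  "iter_q_integral p q 0 g = g []"
| "iter_q_integral p q (Suc r) g =
     q_integral p q (\<lambda>y. iter_q_integral p q r (\<lambda>xs. g (xs @ [y])))"

text \<open>All integrals occurring in the iterated integral over \<open>\<int>\<^sub>p\<close> exist.\<close>

primrec iter_q_integrable ::
    "nat \<Rightarrow> ('a::{field_char_0,complete_space} \<Rightarrow> real) \<Rightarrow> 'a \<Rightarrow> nat \<Rightarrow> ('a list \<Rightarrow> 'a) \<Rightarrow> bool" where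
  "iter_q_integrable p absp q 0 g \<longleftrightarrow> True"
| "iter_q_integrable p absp q (Suc r) g \<longleftrightarrow>
     (\<forall>y\<in>padic_ints absp. iter_q_integrable p absp q r (\<lambda>xs. g (xs @ [y]))) \<and>
     q_integrable p q (\<lambda>y. iter_q_integral p q r (\<lambda>xs. g (xs @ [y])))"

definition q_bernoulli_integrand ::
    "nat \<Rightarrow> 'a::{field_char_0,complete_space} \<Rightarrow> 'a \<Rightarrow> 'a list \<Rightarrow> 'a" where
  "q_bernoulli_integrand n q x xs =
     qpow q (- sum_list xs) * qbracket q (x + sum_list xs) ^ n"

definition q_bernoulli ::
    "nat \<Rightarrow> nat \<Rightarrow> nat \<Rightarrow> 'a::{field_char_0,complete_space} \<Rightarrow> 'a \<Rightarrow> 'a" where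
  "q_bernoulli p r n q x = iter_q_integral p q r (q_bernoulli_integrand n q x)"

text \<open>The quotient of \<open>l\<close> by the \<open>q\<close>-bracket of \<open>l f\<close>, at \<open>l = 0\<close> read as its limiting value.\<close>

definition q_quotient :: "'a::{field_char_0,complete_space} \<Rightarrow> nat \<Rightarrow> nat \<Rightarrow> 'a" where
  "q_quotient q f l =
     (if l = 0 then (q - 1) / (of_nat f * padic_log q)
      else of_nat l / qbracket q (of_nat (l * f)))"

text \<open>The index tuples \<open>(a\<^sub>1, \<dots>, a\<^sub>r)\<close> with \<open>0 \<le> a\<^sub>i \<le> f - 1\<close>.\<close>

definition index_tuples :: "nat \<Rightarrow> nat \<Rightarrow> nat list set" where
  "index_tuples f r = {as. length as = r \<and> set as \<subseteq> {..<f}}"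

end

theory Submission imports Defs "HOL-Number_Theory.Cong" begin

text \<open>
  By the binomial theorem and the additivity of \<open>y \<mapsto> q\<^sup>y\<close> on the \<open>p\<close>-adic
  integers, the integrand is a linear combination, over \<open>l \<le> n\<close>, of the functions
  \<open>q\<^sup>-\<^sup>s q\<^sup>l\<^sup>s\<close> of \<open>s = x\<^sub>1 + \<dots> + x\<^sub>r\<close>, with coefficients
  \<open>binom n l (-1)\<^sup>l q\<^sup>l\<^sup>x / (1 - q)\<^sup>n\<close>. Such a function is a product of functions
  of the single variables, so each of the \<open>r\<close> integrations contributes the same factor. The
  weight \<open>q\<^sup>y\<close> of the integral cancels \<open>q\<^sup>-\<^sup>y\<close>, and the Riemann sums become
  geometric: for \<open>l > 0\<close>,
  \<open>(1 - q) / (1 - q\<^sup>P) * (1 - q\<^sup>l\<^sup>P) / (1 - q\<^sup>l)\<close> with \<open>P = p\<^sup>N\<close>, which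
  tends to \<open>l (1 - q) / (1 - q\<^sup>l)\<close> because \<open>q\<^sup>P\<close> tends to \<open>1\<close>; for
  \<open>l = 0\<close>, \<open>(1 - q) P / (1 - q\<^sup>P)\<close>, which tends to \<open>(q - 1) / log q\<close> because
  \<open>log q\<close> is the derivative at \<open>0\<close> of \<open>y \<mapsto> q\<^sup>y\<close>. In both cases the limit is
  \<open>l / [l]\<^sub>q\<close> (lemmas \<open>lim_geometric_riemann_sum\<close> and
  \<open>iter_q_integral_exponentials\<close>), and this proves the first formula for \<open>f = 1\<close>.

  For general \<open>f\<close> the tuples \<open>(a\<^sub>1, \<dots>, a\<^sub>r)\<close> only redistribute each factor:
  \<open>l / [l]\<^sub>q\<close> is the geometric sum of \<open>q\<^sup>l\<^sup>a\<close> over \<open>a < f\<close> times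
  \<open>l / [l f]\<^sub>q\<close>. The second formula is the first one read for the base \<open>q\<^sup>f\<close>,
  since \<open>(q\<^sup>f)\<close> to the power \<open>y / f\<close> is \<open>q\<^sup>y\<close>, while the factor
  \<open>l / [l]\<close> taken for \<open>q\<^sup>f\<close> is \<open>[f]\<^sub>q\<close> times \<open>l / [l f]\<^sub>q\<close>.

  Two analytic facts carry the argument. Identities between \<open>q\<close>-powers hold for natural
  exponents and extend to the \<open>p\<close>-adic integers by density (\<open>padic_ints_iff\<close>) and
  continuity (\<open>lim_qpow\<close>). The term \<open>l = 0\<close> needs the limit
  \<open>lim_padic_log\<close> and \<open>log q \<noteq> 0\<close> (\<open>padic_log_nonzero\<close>), which is where
  \<open>q\<close> not being a root of unity enters beyond the denominators \<open>1 - q\<^sup>m\<close>.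
\<close>

section \<open>Non-archimedean absolute value\<close>

context padic_complex
begin

lemma absp_0 [simp]: "absp 0 = 0"
  by (simp add: absp_eq_0_iff)

lemma absp_eq_dist: "absp x = dist x 0"
  by (simp add: dist_absp)

lemma absp_nonneg [simp]: "absp x \<ge> 0"
  by (simp add: absp_eq_dist)

lemma absp_1 [simp]: "absp 1 = 1"
proof -
  have "absp 1 * absp 1 = absp 1" using absp_mult[of 1 1] by simp
  then show ?thesis using absp_eq_0_iff[of 1] by simp
qed

lemma absp_minus [simp]: "absp (- x) = absp x"
  using dist_absp[of 0 x] dist_absp[of x 0] by (simp add: dist_commute)

lemma absp_minus_commute: "absp (x - y) = absp (y - x)"
  by (metis absp_minus minus_diff_eq)

lemma absp_diff_le: "absp (x - y) \<le> max (absp x) (absp y)"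
  using absp_ultrametric[of x "- y"] by simp

lemma absp_power: "absp (x ^ n) = absp x ^ n"
  by (induction n) (simp_all add: absp_mult)

lemma absp_inverse: "absp (inverse x) = inverse (absp x)"
proof (cases "x = 0")
  case False
  then have "absp x * absp (inverse x) = 1" by (simp flip: absp_mult)
  then show ?thesis by (metis inverse_unique)
qed simp

lemma absp_divide: "absp (x / y) = absp x / absp y"
  by (simp add: divide_inverse absp_mult absp_inverse)

lemma absp_sum_le:
  assumes "\<And>i. i \<in> A \<Longrightarrow> absp (g i) \<le> B" "B \<ge> 0"
  shows "absp (sum g A) \<le> B"
  using assms
proof (induction A rule: infinite_finite_induct)
  case (insert a A)
  then show ?case using absp_ultrametric[of "g a" "sum g A"] by force
qed auto

lemma absp_of_nat_le: "absp (of_nat n) \<le> 1"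
proof -
  have "absp (\<Sum>i<n. 1) \<le> 1" by (rule absp_sum_le) auto
  then show ?thesis by simp
qed

lemma absp_of_int_le: "absp (of_int i) \<le> 1"
  by (cases i rule: int_cases2) (auto simp: absp_of_nat_le)

text \<open>Every ultrametric triangle is isosceles: its two longest sides are equal.\<close>

lemma absp_eq_of_close: "absp (x - y) < absp y \<Longrightarrow> absp x = absp y"
  using absp_ultrametric[of "x - y" y] absp_diff_le[of x "x - y"] by (auto simp: max_def split: if_splits)

lemma prime_gt_0: "p > 0"
  using prime_p by (simp add: prime_gt_0_nat)

lemma prime_gt_1: "p > 1"
  using prime_p by (rule prime_gt_1_nat)

text \<open>A Bezout relation \<open>u m + v p = 1\<close> makes \<open>m\<close> a unit: its second term is
  smaller than \<open>1\<close>, so the first one must have absolute value \<open>1\<close>.\<close>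

lemma absp_of_int_coprime:
  assumes "coprime m (int p)"
  shows "absp (of_int m) = 1"
proof -
  obtain u v where uv: "u * m + v * int p = 1"
    using assms by (metis bezout_int coprime_iff_gcd_eq_1)
  have "1 = absp (of_int (u * m + v * int p))" by (simp add: uv)
  also have "\<dots> \<le> max (absp (of_int u * of_int m)) (absp (of_int v * of_nat p))"
    using absp_ultrametric[of "of_int u * of_int m" "of_int v * of_nat p"] by simp
  finally have "1 \<le> max (absp (of_int u) * absp (of_int m)) (absp (of_int v) * absp (of_nat p))"
    by (simp add: absp_mult)
  moreover have "absp (of_int v) * absp (of_nat p) < 1"
  proof -
    have "absp (of_int v) * absp (of_nat p) \<le> absp (of_nat p)"
      using absp_of_int_le[of v] by (simp add: mult_left_le_one_le)
    also have "\<dots> < 1" using prime_gt_1 by (simp add: absp_p)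
    finally show ?thesis .
  qed
  ultimately have "1 \<le> absp (of_int u) * absp (of_int m)" by linarith
  moreover have "absp (of_int u) * absp (of_int m) \<le> absp (of_int m)"
    using absp_of_int_le[of u] by (simp add: mult_left_le_one_le)
  ultimately show ?thesis using absp_of_int_le[of m] by linarith
qed

lemma absp_of_nat_coprime: "coprime m p \<Longrightarrow> absp (of_nat m) = 1"
  using absp_of_int_coprime[of "int m"] by simp

text \<open>The power of \<open>p\<close> dividing \<open>n\<close> is at most \<open>n\<close>; this is what makes the
  denominators of the logarithm series harmless.\<close>

lemma inverse_absp_of_nat_le:
  assumes "n > 0"
  shows "1 / absp (of_nat n) \<le> real n"
proof -
  obtain k where k: "n = p ^ multiplicity p n * k" "\<not> p dvd k"
    using multiplicity_decompose'[of n p] assms prime_gt_1 by auto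
  let ?v = "multiplicity p n"
  have "coprime k p" using k(2) prime_p by (metis coprime_commute prime_imp_coprime_nat)
  then have "absp (of_nat n) = (1 / real p) ^ ?v"
    by (subst k(1)) (simp add: absp_mult absp_power absp_p absp_of_nat_coprime)
  then have "1 / absp (of_nat n) = real (p ^ ?v)" by (simp add: power_one_over)
  also have "p ^ ?v \<le> n" using k assms by (metis dvd_imp_le dvd_triv_left)
  finally show ?thesis by simp
qed


section \<open>Limits and series\<close>

text \<open>A field with such an absolute value is not a normed space over the reals, so the continuity
  of the field operations is derived here from \<open>absp\<close>.\<close>

lemma lim_iff_absp: "(X \<longlongrightarrow> L) F \<longleftrightarrow> ((\<lambda>i. absp (X i - L)) \<longlongrightarrow> 0) F"
  by (subst tendsto_dist_iff) (simp add: dist_absp)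

lemma lim_absp: "(X \<longlongrightarrow> L) F \<Longrightarrow> ((\<lambda>i. absp (X i)) \<longlongrightarrow> absp L) F"
  unfolding absp_eq_dist by (intro tendsto_intros)

lemma lim_add:
  fixes L M :: 'a
  assumes "(X \<longlongrightarrow> L) F" "(Y \<longlongrightarrow> M) F"
  shows "((\<lambda>i. X i + Y i) \<longlongrightarrow> L + M) F"
  unfolding lim_iff_absp
proof (rule tendsto_sandwich[where f = "\<lambda>_. 0"])
  show "\<forall>\<^sub>F i in F. absp (X i + Y i - (L + M)) \<le> absp (X i - L) + absp (Y i - M)"
  proof (rule always_eventually, rule allI)
    fix i
    show "absp (X i + Y i - (L + M)) \<le> absp (X i - L) + absp (Y i - M)"
      using absp_ultrametric[of "X i - L" "Y i - M"]
      by (simp add: add_diff_add max_def add_increasing add_increasing2 split: if_splits)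
  qed
  show "((\<lambda>i. absp (X i - L) + absp (Y i - M)) \<longlongrightarrow> 0) F"
    using tendsto_add[OF assms[unfolded lim_iff_absp]] by simp
qed (auto intro: always_eventually)

lemma lim_mult:
  fixes L M :: 'a
  assumes "(X \<longlongrightarrow> L) F" "(Y \<longlongrightarrow> M) F"
  shows "((\<lambda>i. X i * Y i) \<longlongrightarrow> L * M) F"
  unfolding lim_iff_absp
proof (rule tendsto_sandwich[where f = "\<lambda>_. 0"])
  show "\<forall>\<^sub>F i in F. absp (X i * Y i - L * M) \<le> absp (X i - L) * absp (Y i) + absp L * absp (Y i - M)"
  proof (rule always_eventually, rule allI)
    fix i
    have "absp ((X i - L) * Y i + L * (Y i - M)) \<le> max (absp ((X i - L) * Y i)) (absp (L * (Y i - M)))"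
      by (rule absp_ultrametric)
    also have "\<dots> \<le> absp (X i - L) * absp (Y i) + absp L * absp (Y i - M)"
      by (simp add: absp_mult)
    also have "(X i - L) * Y i + L * (Y i - M) = X i * Y i - L * M" by (simp add: algebra_simps)
    finally show "absp (X i * Y i - L * M) \<le> absp (X i - L) * absp (Y i) + absp L * absp (Y i - M)" .
  qed
  have "((\<lambda>i. absp (X i - L) * absp (Y i) + absp L * absp (Y i - M)) \<longlongrightarrow> 0 * absp M + absp L * 0) F"
    by (intro tendsto_intros assms[unfolded lim_iff_absp] lim_absp assms)
  then show "((\<lambda>i. absp (X i - L) * absp (Y i) + absp L * absp (Y i - M)) \<longlongrightarrow> 0) F" by simp
qed (auto intro: always_eventually)

lemma lim_cmult: "(X \<longlongrightarrow> L) F \<Longrightarrow> ((\<lambda>i. c * X i) \<longlongrightarrow> c * L) F" for L :: 'a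
  by (intro lim_mult tendsto_const)

lemma lim_diff:
  fixes L M :: 'a
  assumes "(X \<longlongrightarrow> L) F" "(Y \<longlongrightarrow> M) F"
  shows "((\<lambda>i. X i - Y i) \<longlongrightarrow> L - M) F"
  using lim_add[OF assms(1) lim_cmult[OF assms(2), of "- 1"]] by simp

lemma lim_power: "(X \<longlongrightarrow> L) F \<Longrightarrow> ((\<lambda>i. X i ^ n) \<longlongrightarrow> L ^ n) F" for L :: 'a
  by (induction n) (auto intro: lim_mult)

lemma lim_sum:
  "(\<And>j. j \<in> A \<Longrightarrow> (X j \<longlongrightarrow> L j) F) \<Longrightarrow> ((\<lambda>i. \<Sum>j\<in>A. X j i) \<longlongrightarrow> (\<Sum>j\<in>A. L j)) F"
  for L :: "'b \<Rightarrow> 'a"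
  by (induction A rule: infinite_finite_induct) (auto intro: lim_add)

lemma lim_inverse:
  fixes L :: 'a
  assumes "(X \<longlongrightarrow> L) F" "L \<noteq> 0"
  shows "((\<lambda>i. inverse (X i)) \<longlongrightarrow> inverse L) F"
  unfolding lim_iff_absp
proof (rule Lim_transform_eventually)
  have pos: "absp L > 0" using assms(2) absp_eq_0_iff[of L] absp_nonneg[of L] by linarith
  have "((\<lambda>i. absp (X i - L) / (absp L * absp L)) \<longlongrightarrow> 0 / (absp L * absp L)) F"
    using pos by (intro tendsto_intros assms(1)[unfolded lim_iff_absp]) auto
  then show "((\<lambda>i. absp (X i - L) / (absp L * absp L)) \<longlongrightarrow> 0) F" by simp
  have "\<forall>\<^sub>F i in F. absp (X i - L) < absp L"
    using order_tendstoD(2)[OF assms(1)[unfolded lim_iff_absp] pos] .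
  then show "\<forall>\<^sub>F i in F. absp (X i - L) / (absp L * absp L) = absp (inverse (X i) - inverse L)"
  proof eventually_elim
    case (elim i)
    then have e: "absp (X i) = absp L" by (rule absp_eq_of_close)
    then have "X i \<noteq> 0" using pos by auto
    then have "inverse (X i) - inverse L = (L - X i) / (X i * L)"
      using assms(2) by (simp add: field_simps)
    then show ?case by (simp add: absp_divide absp_mult e absp_minus_commute)
  qed
qed

text \<open>A block of consecutive terms is at most as large as its largest term, so the partial sums of
  a null sequence form a Cauchy sequence.\<close>

lemma summable_if_null:
  assumes "(\<lambda>k. absp (a k)) \<longlonglongrightarrow> 0"
  shows "summable a"
  unfolding summable_iff_convergent
proof (rule Cauchy_convergent, rule metric_CauchyI)
  fix e :: real assume e: "e > 0"
  from order_tendstoD(2)[OF assms, of "e/2"] e obtain K where K: "\<And>k. k \<ge> K \<Longrightarrow> absp (a k) < e/2"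
    by (auto simp: eventually_sequentially)
  have le: "dist (sum a {..<m}) (sum a {..<n}) < e" if "K \<le> n" "n \<le> m" for m n
  proof -
    have "sum a {..<m} = sum a {..<n} + sum a {n..<m}"
      using that by (metis atLeast0LessThan le0 sum.atLeastLessThan_concat)
    moreover have "absp (sum a {n..<m}) \<le> e/2"
      using K that e by (intro absp_sum_le) (auto intro: less_imp_le)
    ultimately show ?thesis using e by (simp add: dist_absp)
  qed
  show "\<exists>M. \<forall>m\<ge>M. \<forall>n\<ge>M. dist (sum a {..<m}) (sum a {..<n}) < e"
    by (rule exI[of _ K]) (metis le dist_commute nle_le)
qed

text \<open>Two series differ by no more than their terms do, however many terms there are.\<close>

lemma sums_diff_le:
  assumes "a sums S" "b sums T" "\<And>k. absp (a k - b k) \<le> B"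
  shows "absp (S - T) \<le> B"
proof -
  have B: "B \<ge> 0" using assms(3)[of 0] absp_nonneg order_trans by blast
  have "(\<lambda>n. sum a {..<n} - sum b {..<n}) \<longlonglongrightarrow> S - T"
    using assms(1,2) unfolding sums_def by (rule lim_diff)
  then have "(\<lambda>n. \<Sum>k<n. a k - b k) \<longlonglongrightarrow> S - T" by (simp add: sum_subtractf)
  from lim_absp[OF this] show ?thesis
    by (rule LIMSEQ_le_const2) (auto intro!: absp_sum_le assms(3) B)
qed

text \<open>Dominated convergence: as only the largest difference of terms matters, it is enough
  that the dominating sequence is a null sequence.\<close>

lemma lim_suminf_dominated:
  assumes lim: "\<And>k. (\<lambda>j. a j k) \<longlonglongrightarrow> c k"
    and le: "\<And>j k. absp (a j k) \<le> b k" and b: "b \<longlonglongrightarrow> 0"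
  shows "(\<lambda>j. \<Sum>k. a j k) \<longlonglongrightarrow> (\<Sum>k. c k)"
proof -
  have null: "summable u" if "\<And>k. absp (u k) \<le> b k" for u
    by (rule summable_if_null, rule tendsto_sandwich[OF _ _ tendsto_const b])
       (use that in \<open>auto intro: always_eventually\<close>)
  have lec: "absp (c k) \<le> b k" for k
    using lim_absp[OF lim] by (rule LIMSEQ_le_const2) (auto simp: le)
  show ?thesis
  proof (rule metric_LIMSEQ_I)
    fix e :: real assume e: "e > 0"
    from order_tendstoD(2)[OF b, of "e/2"] e obtain K where K: "\<And>k. k \<ge> K \<Longrightarrow> b k < e/2"
      by (auto simp: eventually_sequentially)
    have "\<forall>\<^sub>F j in sequentially. \<forall>k\<in>{..<K}. absp (a j k - c k) < e/2"
      using e order_tendstoD(2)[OF lim[unfolded lim_iff_absp], of "e/2"]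
      by (intro eventually_ball_finite) auto
    then obtain J where J: "\<And>j k. j \<ge> J \<Longrightarrow> k < K \<Longrightarrow> absp (a j k - c k) < e/2"
      by (auto simp: eventually_sequentially)
    have "absp ((\<Sum>k. a j k) - (\<Sum>k. c k)) \<le> e/2" if "j \<ge> J" for j
    proof (rule sums_diff_le)
      show "(\<lambda>k. a j k) sums (\<Sum>k. a j k)" "c sums (\<Sum>k. c k)"
        by (intro summable_sums null le lec)+
      show "absp (a j k - c k) \<le> e/2" for k
      proof (cases "k < K")
        case True then show ?thesis using J[OF that] by (simp add: less_imp_le)
      next
        case False
        then show ?thesis using K[of k] absp_diff_le[of "a j k" "c k"] le[of j k] lec[of k] by auto
      qed
    qed
    then show "\<exists>J. \<forall>j\<ge>J. dist (\<Sum>k. a j k) (\<Sum>k. c k) < e"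
      using e by (intro exI[of _ J]) (force simp: dist_absp)
  qed
qed

lemma absp_p_power_null: "(\<lambda>N. absp (of_nat (p ^ N))) \<longlonglongrightarrow> 0"
  using prime_gt_1 by (simp add: absp_power absp_p LIMSEQ_power_zero)

lemma lim_p_power: "(\<lambda>N. of_nat (p ^ N)) \<longlonglongrightarrow> (0 :: 'a)"
  unfolding lim_iff_absp using absp_p_power_null by simp


section \<open>The ring of \<open>p\<close>-adic integers\<close>

text \<open>A fraction \<open>a / b\<close> in lowest terms with absolute value at most \<open>1\<close> has
  \<open>b\<close> prime to \<open>p\<close>; solving \<open>b m = a\<close> modulo \<open>p\<^sup>N\<close> then gives
  a natural number at distance at most \<open>p\<^sup>-\<^sup>N\<close>.\<close>

lemma rat_approx_nat:
  assumes "y \<in> \<rat>" "absp y \<le> 1" "e > 0"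
  obtains m :: nat where "absp (y - of_nat m) < e"
proof -
  obtain a b where ab: "b > 0" "coprime a b" "y = of_int a / of_int b"
    using assms(1) by (rule Rats_cases')
  have "coprime b (int p)"
  proof (rule ccontr)
    assume "\<not> coprime b (int p)"
    then have dvd: "int p dvd b"
      using prime_p by (metis coprime_commute prime_imp_coprime prime_nat_int_transfer)
    then obtain c where c: "b = int p * c" ..
    have "coprime a (int p)" using ab(2) dvd by (meson coprime_divisors dvd_refl)
    then have "absp (of_int a) = 1" by (rule absp_of_int_coprime)
    moreover have "absp (of_int b) < 1"
    proof -
      have "absp (of_int b) = absp (of_int c) / real p"
        by (simp add: c absp_mult absp_p)
      also have "\<dots> \<le> 1 / real p" using absp_of_int_le[of c] by (simp add: divide_right_mono)
      also have "\<dots> < 1" using prime_gt_1 by simp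
      finally show ?thesis .
    qed
    moreover have "absp (of_int b) > 0"
      using ab(1) absp_eq_0_iff[of "of_int b"] absp_nonneg[of "of_int b"] by (simp add: less_le)
    ultimately have "absp y > 1" by (simp add: ab(3) absp_divide)
    then show False using assms(2) by simp
  qed
  obtain N where N: "absp (of_nat (p ^ N)) < e"
    using order_tendstoD(2)[OF absp_p_power_null assms(3)] by (auto simp: eventually_sequentially)
  have "coprime b (int p ^ N)" using \<open>coprime b (int p)\<close> by simp
  then obtain u where u: "[b * u = 1] (mod (int p ^ N))"
    using cong_solve_coprime_int by blast
  define m where "m = nat ((u * a) mod int p ^ N)"
  have "int m = (u * a) mod int p ^ N" unfolding m_def using prime_gt_0 by simp
  then have "[int m = u * a] (mod int p ^ N)" by (simp add: cong_def)
  then have "[b * int m = b * (u * a)] (mod int p ^ N)" by (rule cong_scalar_left)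
  moreover have "[b * u * a = 1 * a] (mod int p ^ N)" using u by (rule cong_scalar_right)
  ultimately have "[a = b * int m] (mod int p ^ N)"
    by (metis cong_sym cong_trans mult.assoc mult_1)
  then obtain t where t: "a - b * int m = int p ^ N * t"
    by (auto simp: cong_iff_dvd_diff)
  have "y - of_nat m = of_int (a - b * int m) / of_int b"
    using ab(1) by (simp add: ab(3) field_simps)
  then have "absp (y - of_nat m) = absp (of_int (int p ^ N * t))"
    by (simp only: t absp_divide absp_of_int_coprime[OF \<open>coprime b (int p)\<close>])
  also have "\<dots> = absp (of_nat (p ^ N)) * absp (of_int t)" by (simp add: absp_mult)
  also have "\<dots> \<le> absp (of_nat (p ^ N))" using absp_of_int_le[of t] by (simp add: mult_left_le)
  finally have "absp (y - of_nat m) < e" using N by linarith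
  then show ?thesis by (rule that)
qed

text \<open>Natural numbers are dense in the \<open>p\<close>-adic integers. All identities between
  \<open>q\<close>-powers with exponents in this ring are obtained by continuity from this fact.\<close>

lemma padic_ints_iff: "y \<in> padic_ints absp \<longleftrightarrow> (\<forall>e>0. \<exists>m. absp (y - of_nat m) < e)"
proof
  assume y: "y \<in> padic_ints absp"
  show "\<forall>e>0. \<exists>m. absp (y - of_nat m) < e"
  proof (intro allI impI)
    fix e :: real assume e: "e > 0"
    have "y \<in> closure \<rat>" using y by (simp add: padic_ints_def padic_rats_def)
    then obtain z where z: "z \<in> \<rat>" "dist z y < min e 1"
      using e by (meson closure_approachable min_less_iff_conj zero_less_one)
    have zy: "absp (y - z) < min e 1" using z(2) by (simp add: dist_absp absp_minus_commute)
    have "absp z \<le> 1"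
      using absp_diff_le[of y "y - z"] zy y by (auto simp: padic_ints_def)
    with z(1) e obtain m where "absp (z - of_nat m) < e" by (blast elim: rat_approx_nat)
    then have "absp (y - of_nat m) < e"
      using absp_ultrametric[of "y - z" "z - of_nat m"] zy by auto
    then show "\<exists>m. absp (y - of_nat m) < e" ..
  qed
next
  assume r: "\<forall>e>0. \<exists>m. absp (y - of_nat m) < e"
  have "y \<in> closure \<rat>"
    unfolding closure_approachable dist_absp by (metis r absp_minus_commute Rats_of_nat)
  moreover obtain m where "absp (y - of_nat m) < 1" using r zero_less_one by blast
  then have "absp y \<le> 1"
    using absp_ultrametric[of "y - of_nat m" "of_nat m"] absp_of_nat_le[of m] by auto
  ultimately show "y \<in> padic_ints absp" by (simp add: padic_ints_def padic_rats_def)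
qed

lemma padic_ints_seq:
  assumes "y \<in> padic_ints absp"
  obtains m :: "nat \<Rightarrow> nat" where "(\<lambda>i. of_nat (m i)) \<longlonglongrightarrow> y"
proof -
  have "\<forall>i. \<exists>m. absp (y - of_nat m) < inverse (real (Suc i))"
    using assms unfolding padic_ints_iff by simp
  then obtain m where m: "\<And>i. absp (y - of_nat (m i)) < inverse (real (Suc i))" by metis
  have "(\<lambda>i. absp (of_nat (m i) - y)) \<longlonglongrightarrow> 0"
    by (rule tendsto_sandwich[OF _ _ tendsto_const LIMSEQ_inverse_real_of_nat])
       (use m in \<open>auto intro!: always_eventually less_imp_le simp: absp_minus_commute\<close>)
  then show ?thesis using that by (simp add: lim_iff_absp)
qed

lemma padic_ints_lim_nat:
  assumes "(\<lambda>i. of_nat (m i)) \<longlonglongrightarrow> y"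
  shows "y \<in> padic_ints absp"
  unfolding padic_ints_iff
proof (intro allI impI)
  fix e :: real assume "e > 0"
  from order_tendstoD(2)[OF assms[unfolded lim_iff_absp] this]
  show "\<exists>m. absp (y - of_nat m) < e"
    by (auto simp: eventually_sequentially absp_minus_commute)
qed

lemma padic_ints_of_nat: "of_nat m \<in> padic_ints absp"
  by (rule padic_ints_lim_nat) (rule tendsto_const)

lemma padic_ints_add:
  assumes "y \<in> padic_ints absp" "z \<in> padic_ints absp"
  shows "y + z \<in> padic_ints absp"
proof -
  obtain m k where "(\<lambda>i. of_nat (m i)) \<longlonglongrightarrow> y" "(\<lambda>i. of_nat (k i)) \<longlonglongrightarrow> z"
    using assms by (metis padic_ints_seq)
  from lim_add[OF this] show ?thesis by (intro padic_ints_lim_nat[of "\<lambda>i. m i + k i"]) simp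
qed

lemma padic_ints_mult:
  assumes "y \<in> padic_ints absp" "z \<in> padic_ints absp"
  shows "y * z \<in> padic_ints absp"
proof -
  obtain m k where "(\<lambda>i. of_nat (m i)) \<longlonglongrightarrow> y" "(\<lambda>i. of_nat (k i)) \<longlonglongrightarrow> z"
    using assms by (metis padic_ints_seq)
  from lim_mult[OF this] show ?thesis by (intro padic_ints_lim_nat[of "\<lambda>i. m i * k i"]) simp
qed

lemma Rats_padic_ints: "y \<in> \<rat> \<Longrightarrow> absp y \<le> 1 \<Longrightarrow> y \<in> padic_ints absp"
  using closure_subset[of "\<rat> :: 'a set"] by (auto simp: padic_ints_def padic_rats_def)

lemma padic_ints_minus: "y \<in> padic_ints absp \<Longrightarrow> - y \<in> padic_ints absp"
  using padic_ints_mult[OF Rats_padic_ints[of "- 1"]] by simp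

lemma padic_ints_divide:
  assumes "y \<in> padic_ints absp" "coprime f p"
  shows "y / of_nat f \<in> padic_ints absp"
proof -
  have "inverse (of_nat f) \<in> padic_ints absp"
    by (rule Rats_padic_ints) (use assms in \<open>auto simp: absp_inverse absp_of_nat_coprime\<close>)
  then show ?thesis using padic_ints_mult[OF assms(1)] by (simp add: divide_inverse)
qed

lemma padic_ints_sum_list: "set ys \<subseteq> padic_ints absp \<Longrightarrow> sum_list ys \<in> padic_ints absp"
  using padic_ints_of_nat[of 0] by (induction ys) (auto intro: padic_ints_add)


section \<open>Powers with \<open>p\<close>-adic integer exponents\<close>

lemma lim_gbinomial: "(X \<longlongrightarrow> y) F \<Longrightarrow> ((\<lambda>i. X i gchoose k) \<longlongrightarrow> y gchoose k) F" for y :: 'a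
proof (induction k)
  case (Suc k)
  have eq: "z gchoose Suc k = inverse (of_nat (Suc k)) * ((z gchoose k) * (z - of_nat k))" for z :: 'a
    using gbinomial_mult_1[of z k] by (simp add: field_simps del: of_nat_Suc)
  show ?case unfolding eq by (intro lim_cmult lim_mult Suc lim_diff tendsto_const)
qed simp

text \<open>Binomial coefficients of natural numbers are integers, and this bound survives limits.\<close>

lemma absp_gbinomial_le:
  assumes "y \<in> padic_ints absp"
  shows "absp (y gchoose k) \<le> 1"
proof -
  obtain m where "(\<lambda>i. of_nat (m i)) \<longlonglongrightarrow> y" using padic_ints_seq[OF assms] .
  from lim_absp[OF lim_gbinomial[OF this]] show ?thesis
    by (rule LIMSEQ_le_const2) (auto simp: absp_of_nat_le simp flip: binomial_gbinomial)
qed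

lemma qpow_of_nat: "qpow q (of_nat m) = q ^ m" for q :: 'a
proof -
  have "qpow q (of_nat m) = (\<Sum>k\<le>m. (of_nat m gchoose k) * (q - 1) ^ k)"
    unfolding qpow_def
    by (rule suminf_finite) (auto simp: binomial_eq_0 simp flip: binomial_gbinomial)
  also have "\<dots> = ((q - 1) + 1) ^ m"
    by (subst binomial_ring) (simp flip: binomial_gbinomial)
  finally show ?thesis by simp
qed

lemma qpow_0 [simp]: "qpow q 0 = 1" for q :: 'a
  using qpow_of_nat[of q 0] by simp

text \<open>The binomial series converges uniformly on the \<open>p\<close>-adic integers, where its
  coefficients are bounded by \<open>1\<close>.\<close>

lemma lim_qpow:
  assumes q: "absp (1 - q) < 1" and "\<And>i. X i \<in> padic_ints absp" and y: "X \<longlonglongrightarrow> y"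
  shows "(\<lambda>i. qpow q (X i)) \<longlonglongrightarrow> qpow q y"
  unfolding qpow_def
proof (rule lim_suminf_dominated)
  show "(\<lambda>i. (X i gchoose k) * (q - 1) ^ k) \<longlonglongrightarrow> (y gchoose k) * (q - 1) ^ k" for k
    by (intro lim_mult lim_gbinomial y tendsto_const)
  show "absp ((X i gchoose k) * (q - 1) ^ k) \<le> absp (1 - q) ^ k" for i k
    using absp_gbinomial_le[OF assms(2), of i k]
    by (simp add: absp_mult absp_power absp_minus_commute mult_left_le_one_le)
  show "(\<lambda>k. absp (1 - q) ^ k) \<longlonglongrightarrow> 0" using q by (simp add: LIMSEQ_power_zero)
qed

lemma lim_qpow_of_nat:
  assumes "absp (1 - q) < 1" "(\<lambda>i. of_nat (m i)) \<longlonglongrightarrow> y"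
  shows "(\<lambda>i. q ^ m i) \<longlonglongrightarrow> qpow q y"
  using lim_qpow[OF assms(1) padic_ints_of_nat assms(2)] by (simp add: qpow_of_nat)

lemma qpow_add:
  assumes q: "absp (1 - q) < 1" and "y \<in> padic_ints absp" "z \<in> padic_ints absp"
  shows "qpow q (y + z) = qpow q y * qpow q z"
proof -
  obtain m k where mk: "(\<lambda>i. of_nat (m i)) \<longlonglongrightarrow> y" "(\<lambda>i. of_nat (k i)) \<longlonglongrightarrow> z"
    using assms by (metis padic_ints_seq)
  have "(\<lambda>i. of_nat (m i + k i)) \<longlonglongrightarrow> y + z" using lim_add[OF mk] by simp
  from lim_qpow_of_nat[OF q this] have "(\<lambda>i. q ^ m i * q ^ k i) \<longlonglongrightarrow> qpow q (y + z)"
    by (simp add: power_add)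
  moreover have "(\<lambda>i. q ^ m i * q ^ k i) \<longlonglongrightarrow> qpow q y * qpow q z"
    by (intro lim_mult lim_qpow_of_nat q mk)
  ultimately show ?thesis by (rule LIMSEQ_unique)
qed

lemma qpow_minus:
  assumes "absp (1 - q) < 1" "y \<in> padic_ints absp"
  shows "qpow q (- y) * qpow q y = 1"
  using qpow_add[OF assms(1) padic_ints_minus[OF assms(2)] assms(2)] by simp

lemma qpow_of_nat_mult:
  assumes "absp (1 - q) < 1" "y \<in> padic_ints absp"
  shows "qpow q (of_nat l * y) = qpow q y ^ l"
proof (induction l)
  case (Suc l)
  show ?case
    using qpow_add[OF assms(1,2) padic_ints_mult[OF padic_ints_of_nat assms(2)], of l] Suc
    by (simp add: algebra_simps)
qed simp

lemma absp_le_1_if_near_1: "absp (1 - q) \<le> 1 \<Longrightarrow> absp q \<le> 1"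
  using absp_diff_le[of 1 "1 - q"] by simp

lemma absp_power_minus_1_le:
  assumes "absp (1 - q) \<le> 1"
  shows "absp (1 - q ^ k) \<le> absp (1 - q)"
proof -
  have "absp (\<Sum>i<k. q ^ i) \<le> 1"
    using absp_le_1_if_near_1[OF assms] by (intro absp_sum_le) (auto simp: absp_power power_le_one)
  then show ?thesis by (simp add: one_diff_power_eq absp_mult mult_left_le)
qed

lemma qpow_power_base:
  assumes q: "absp (1 - q) < 1" and "y \<in> padic_ints absp"
  shows "qpow (q ^ f) y = qpow q (of_nat f * y)"
proof -
  obtain m where m: "(\<lambda>i. of_nat (m i)) \<longlonglongrightarrow> y" using assms by (metis padic_ints_seq)
  have "absp (1 - q ^ f) < 1" using absp_power_minus_1_le[of q f] q by linarith
  from lim_qpow_of_nat[OF this m] have "(\<lambda>i. q ^ (f * m i)) \<longlonglongrightarrow> qpow (q ^ f) y"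
    by (simp add: power_mult)
  moreover have "(\<lambda>i. of_nat (f * m i)) \<longlonglongrightarrow> of_nat f * y" using lim_cmult[OF m] by simp
  from lim_qpow_of_nat[OF q this] have "(\<lambda>i. q ^ (f * m i)) \<longlonglongrightarrow> qpow q (of_nat f * y)" .
  ultimately show ?thesis by (rule LIMSEQ_unique)
qed

lemma lim_power_p_power:
  assumes "absp (1 - q) < 1"
  shows "(\<lambda>N. q ^ (p ^ N)) \<longlonglongrightarrow> 1"
  using lim_qpow_of_nat[OF assms lim_p_power] by simp


section \<open>The logarithm as a derivative\<close>

text \<open>As \<open>p\<^sup>N\<close> tends to \<open>0\<close>, the binomial coefficient tends to that of
  \<open>-1\<close>.\<close>

lemma lim_binomial_p_power: "(\<lambda>N. of_nat ((p ^ N - 1) choose k)) \<longlonglongrightarrow> (-1 :: 'a) ^ k"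
proof -
  have "(\<lambda>N. (of_nat (p ^ N) - 1) gchoose k) \<longlonglongrightarrow> (0 - 1 :: 'a) gchoose k"
    by (intro lim_gbinomial lim_diff lim_p_power tendsto_const)
  moreover have "(0 - 1 :: 'a) gchoose k = (-1) ^ k"
    using gbinomial_minus[of "1 :: 'a" k] by (simp flip: binomial_gbinomial add: gbinomial_of_nat_symmetric)
  ultimately show ?thesis using prime_gt_0
    by (simp add: binomial_gbinomial of_nat_diff Suc_leI)
qed

text \<open>The difference quotient is expanded so that, for \<open>m = p\<^sup>N\<close>, its terms tend to those
  of the logarithm series: \<open>binom m (k + 1) / m = binom (m - 1) k / (k + 1)\<close>.\<close>

lemma power_diff_quotient_sum:
  fixes q :: 'a
  assumes "m > 0"
  shows "(q ^ m - 1) / of_nat m =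
    (\<Sum>k. of_nat ((m - 1) choose k) * ((q - 1) ^ Suc k / of_nat (Suc k)))"
proof -
  obtain m' where m: "m = Suc m'" using assms by (cases m) auto
  have "(\<Sum>k. of_nat ((m - 1) choose k) * ((q - 1) ^ Suc k / of_nat (Suc k)))
      = (\<Sum>k\<le>m'. of_nat (m' choose k) * ((q - 1) ^ Suc k / of_nat (Suc k)))"
    by (simp add: m, rule suminf_finite) (auto simp: binomial_eq_0)
  also have "\<dots> = (\<Sum>k\<le>m'. of_nat (m choose Suc k) * (q - 1) ^ Suc k / of_nat m)"
  proof (rule sum.cong[OF refl])
    fix k
    have "of_nat (Suc k) * of_nat (m choose Suc k) = (of_nat m * of_nat (m' choose k) :: 'a)"
      unfolding m by (metis Suc_times_binomial of_nat_mult)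
    moreover have "(of_nat (Suc k) :: 'a) \<noteq> 0" "(of_nat m :: 'a) \<noteq> 0" unfolding m by (rule of_nat_neq_0)+
    ultimately have "(of_nat (m' choose k) / of_nat (Suc k) :: 'a) = of_nat (m choose Suc k) / of_nat m"
      by (simp add: frac_eq_eq mult.commute del: of_nat_Suc)
    then show "of_nat (m' choose k) * ((q - 1) ^ Suc k / of_nat (Suc k))
        = of_nat (m choose Suc k) * (q - 1) ^ Suc k / of_nat m"
      by (metis times_divide_eq_left times_divide_eq_right)
  qed
  also have "\<dots> = (((q - 1) + 1) ^ m - 1) / of_nat m"
    unfolding sum_divide_distrib[symmetric] binomial_ring m sum.atMost_Suc_shift by simp
  finally show ?thesis by simp
qed

lemma lim_padic_log:
  assumes q: "absp (1 - q) < 1"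
  shows "(\<lambda>N. (q ^ (p ^ N) - 1) / of_nat (p ^ N)) \<longlonglongrightarrow> padic_log q"
proof -
  define t where "t k = (q - 1) ^ Suc k / of_nat (Suc k)" for k
  have "(\<lambda>N. \<Sum>k. of_nat ((p ^ N - 1) choose k) * t k) \<longlonglongrightarrow> (\<Sum>k. (-1) ^ k * t k)"
  proof (rule lim_suminf_dominated)
    show "(\<lambda>N. of_nat ((p ^ N - 1) choose k) * t k) \<longlonglongrightarrow> (-1) ^ k * t k" for k
      by (intro lim_mult lim_binomial_p_power tendsto_const)
    show "absp (of_nat ((p ^ N - 1) choose k) * t k) \<le> real (Suc k) * absp (1 - q) ^ Suc k" for N k
    proof -
      have "absp (of_nat ((p ^ N - 1) choose k) * t k) \<le> absp (t k)"
        using absp_of_nat_le[of "(p ^ N - 1) choose k"] by (simp add: absp_mult mult_left_le_one_le)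
      also have "\<dots> = 1 / absp (of_nat (Suc k)) * absp (1 - q) ^ Suc k"
        by (simp only: t_def absp_divide absp_power absp_minus_commute[of q]) simp
      also have "\<dots> \<le> real (Suc k) * absp (1 - q) ^ Suc k"
        by (intro mult_right_mono inverse_absp_of_nat_le) auto
      finally show ?thesis .
    qed
    show "(\<lambda>k. real (Suc k) * absp (1 - q) ^ Suc k) \<longlonglongrightarrow> 0"
      using LIMSEQ_Suc[OF powser_times_n_limit_0[of "absp (1 - q)"]] q by simp
  qed
  then show ?thesis
    using prime_gt_0 by (simp only: power_diff_quotient_sum zero_less_power t_def padic_log_def times_divide_eq_right)
qed

text \<open>The logarithm of a power follows from the limit above, since
  \<open>w\<^sup>f - 1 = (w - 1) (1 + w + \<dots> + w\<^sup>f\<^sup>-\<^sup>1)\<close> for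
  \<open>w = q ^ p ^ N\<close>, and the last factor tends to \<open>f\<close>.\<close>

lemma padic_log_power:
  assumes q: "absp (1 - q) < 1"
  shows "padic_log (q ^ f) = of_nat f * padic_log q"
proof (rule LIMSEQ_unique)
  have "absp (1 - q ^ f) < 1" using absp_power_minus_1_le[of q f] q by linarith
  from lim_padic_log[OF this]
  show "(\<lambda>N. ((q ^ f) ^ (p ^ N) - 1) / of_nat (p ^ N)) \<longlonglongrightarrow> padic_log (q ^ f)" .
  have "(\<lambda>N. (\<Sum>j<f. (q ^ (p ^ N)) ^ j) * ((q ^ (p ^ N) - 1) / of_nat (p ^ N)))
      \<longlonglongrightarrow> (\<Sum>j<f. 1 ^ j) * padic_log q"
    by (intro lim_mult lim_sum lim_power lim_power_p_power lim_padic_log q)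
  moreover have "(\<lambda>N. (\<Sum>j<f. (q ^ (p ^ N)) ^ j) * ((q ^ (p ^ N) - 1) / of_nat (p ^ N)))
      = (\<lambda>N. ((q ^ f) ^ (p ^ N) - 1) / of_nat (p ^ N))"
  proof
    fix N
    have "(q ^ f) ^ (p ^ N) - 1 = (q ^ (p ^ N) - 1) * (\<Sum>j<f. (q ^ (p ^ N)) ^ j)"
      using power_diff_1_eq[of "q ^ (p ^ N)" f] by (simp add: mult.commute flip: power_mult)
    then show "(\<Sum>j<f. (q ^ (p ^ N)) ^ j) * ((q ^ (p ^ N) - 1) / of_nat (p ^ N))
      = ((q ^ f) ^ (p ^ N) - 1) / of_nat (p ^ N)" by (simp add: mult.commute)
  qed
  ultimately show "(\<lambda>N. ((q ^ f) ^ (p ^ N) - 1) / of_nat (p ^ N)) \<longlonglongrightarrow> of_nat f * padic_log q"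
    by simp
qed

text \<open>Near \<open>1\<close>, raising to the power \<open>p\<close> divides the distance to \<open>1\<close> by
  exactly \<open>p\<close>, because every term of \<open>1 + w + \<dots> + w ^ (p - 1)\<close> is close to
  \<open>1\<close>, so that the sum has the absolute value of \<open>p\<close>.\<close>

lemma absp_power_p_minus_1:
  assumes "absp (1 - w) < 1 / real p"
  shows "absp (1 - w ^ p) = absp (1 - w) / real p"
proof -
  have "1 / real p \<le> 1" using prime_gt_0 by simp
  then have w: "absp (1 - w) \<le> 1" using assms by linarith
  have "absp ((\<Sum>i<p. w ^ i) - of_nat p) = absp (\<Sum>i<p. w ^ i - 1)"
    by (simp add: sum_subtractf)
  also have "\<dots> \<le> absp (1 - w)"
    using absp_power_minus_1_le[OF w] by (intro absp_sum_le) (auto simp: absp_minus_commute)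
  finally have "absp (\<Sum>i<p. w ^ i) = absp (of_nat p)"
    using assms by (intro absp_eq_of_close) (simp add: absp_p)
  then show ?thesis by (simp add: one_diff_power_eq absp_mult absp_p)
qed

text \<open>By the preceding fact the absolute values of \<open>(q ^ p ^ N - 1) / p ^ N\<close>
  are eventually constant, so their limit vanishes only if some \<open>q ^ p ^ N\<close> is \<open>1\<close>.\<close>

lemma padic_log_nonzero:
  assumes q: "absp (1 - q) < 1" and unity: "\<And>m. m > 0 \<Longrightarrow> q ^ m \<noteq> 1"
  shows "padic_log q \<noteq> 0"
proof -
  have "1 / real p > 0" using prime_gt_0 by simp
  from order_tendstoD(2)[OF lim_power_p_power[OF q, unfolded lim_iff_absp] this]
  obtain M where M: "absp (1 - q ^ (p ^ M)) < 1 / real p"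
    by (auto simp: eventually_sequentially absp_minus_commute)
  let ?d = "absp (1 - q ^ (p ^ M))"
  have pp: "(1 / real p) ^ i \<le> 1" for i using prime_gt_0 by (intro power_le_one) auto
  have step: "absp (1 - q ^ (p ^ (M + i))) = ?d * (1 / real p) ^ i" for i
  proof (induction i)
    case (Suc i)
    have "?d * (1 / real p) ^ i \<le> ?d" using pp[of i] by (simp add: mult_left_le)
    then have "absp (1 - (q ^ (p ^ (M + i))) ^ p) = absp (1 - q ^ (p ^ (M + i))) / real p"
      using Suc M by (intro absp_power_p_minus_1) linarith
    moreover have "(q ^ (p ^ (M + i))) ^ p = q ^ (p ^ (M + Suc i))"
      by (simp add: mult.commute flip: power_mult)
    ultimately show ?case using Suc by (simp add: field_simps)
  qed simp
  have "absp ((q ^ (p ^ (i + M)) - 1) / of_nat (p ^ (i + M))) = ?d * real p ^ M" for i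
  proof -
    have "absp ((q ^ (p ^ (i + M)) - 1) / of_nat (p ^ (i + M)))
        = ?d * (1 / real p) ^ i / (1 / real p) ^ (i + M)"
      using step[of i] by (simp add: absp_divide absp_power absp_p absp_minus_commute add.commute)
    also have "\<dots> = ?d * real p ^ M" using prime_gt_0 by (simp add: power_add field_simps)
    finally show ?thesis .
  qed
  moreover have "(\<lambda>i. absp ((q ^ (p ^ (i + M)) - 1) / of_nat (p ^ (i + M)))) \<longlonglongrightarrow> absp (padic_log q)"
    using lim_absp[OF LIMSEQ_ignore_initial_segment[OF lim_padic_log[OF q]]] .
  ultimately have "absp (padic_log q) = ?d * real p ^ M" by (simp add: LIMSEQ_const_iff)
  moreover have "?d \<noteq> 0" using unity[of "p ^ M"] prime_gt_0 by (simp add: absp_eq_0_iff)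
  ultimately show ?thesis using prime_gt_0 absp_0 by (metis mult_eq_0_iff of_nat_0_eq_iff power_not_zero neq0_conv)
qed

end


section \<open>Moments of the \<open>q\<close>-integral\<close>

locale padic_q = padic_complex p absp
  for p and absp :: "'a::{field_char_0,complete_space} \<Rightarrow> real" +
  fixes q :: 'a
  assumes near_1: "absp (1 - q) < 1"
    and not_unity: "m > 0 \<Longrightarrow> q ^ m \<noteq> 1"
begin

lemma qbracket_of_nat: "qbracket q (of_nat m) = (1 - q ^ m) / (1 - q)"
  by (simp add: qbracket_def qpow_of_nat)

lemma one_minus_power_nonzero: "m > 0 \<Longrightarrow> 1 - q ^ m \<noteq> 0"
  using not_unity[of m] by simp

lemma one_minus_nonzero: "1 - q \<noteq> 0"
  using one_minus_power_nonzero[of 1] by simp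

text \<open>For \<open>l = 0\<close> the Riemann sum is \<open>q - 1\<close> over the difference quotient of
  \<open>q\<^sup>y\<close> at \<open>0\<close>. For \<open>l > 0\<close>, write \<open>w = q ^ p ^ N\<close>; dividing
  \<open>1 - w\<^sup>l\<close> by \<open>1 - w\<close> leaves \<open>1 + w + \<dots> + w\<^sup>l\<^sup>-\<^sup>1\<close>, which tends
  to \<open>l\<close>.\<close>

lemma lim_geometric_riemann_sum:
  "(\<lambda>N. 1 / qbracket q (of_nat (p ^ N)) * (\<Sum>m<p ^ N. (q ^ l) ^ m)) \<longlonglongrightarrow> q_quotient q 1 l"
proof (cases "l = 0")
  case True
  let ?L = "\<lambda>N. (q - 1) * inverse ((q ^ (p ^ N) - 1) / of_nat (p ^ N))"
  have "?L \<longlonglongrightarrow> (q - 1) * inverse (padic_log q)"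
    by (intro lim_cmult lim_inverse lim_padic_log near_1 padic_log_nonzero not_unity)
  moreover have "?L N = 1 / qbracket q (of_nat (p ^ N)) * (\<Sum>m<p ^ N. (q ^ l) ^ m)" for N
    using one_minus_power_nonzero[of "p ^ N"] one_minus_nonzero prime_gt_0
    by (simp add: True qbracket_of_nat del: of_nat_power) (simp add: field_simps del: of_nat_power)
  ultimately show ?thesis by (simp add: True q_quotient_def field_simps)
next
  case False
  let ?L = "\<lambda>N. (1 - q) / (1 - q ^ l) * (\<Sum>j<l. (q ^ (p ^ N)) ^ j)"
  have "?L \<longlonglongrightarrow> (1 - q) / (1 - q ^ l) * (\<Sum>j<l. 1 ^ j)"
    by (intro lim_cmult lim_sum lim_power lim_power_p_power near_1)
  moreover have "?L N = 1 / qbracket q (of_nat (p ^ N)) * (\<Sum>m<p ^ N. (q ^ l) ^ m)" for N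
  proof -
    have n: "1 - q ^ (p ^ N) \<noteq> 0" "1 - q ^ l \<noteq> 0" "1 - q \<noteq> 0"
      using one_minus_power_nonzero[of "p ^ N"] one_minus_power_nonzero[of l] one_minus_nonzero
        prime_gt_0 False by auto
    have "(1 - q ^ (p ^ N)) * (\<Sum>j<l. (q ^ (p ^ N)) ^ j) = 1 - q ^ (p ^ N * l)"
      by (simp add: power_mult one_diff_power_eq)
    moreover have "(1 - q ^ l) * (\<Sum>m<p ^ N. (q ^ l) ^ m) = 1 - q ^ (p ^ N * l)"
      using one_diff_power_eq[of "q ^ l" "p ^ N"] by (simp add: mult.commute flip: power_mult)
    ultimately have "(1 - q ^ (p ^ N)) * (\<Sum>j<l. (q ^ (p ^ N)) ^ j) = (1 - q ^ l) * (\<Sum>m<p ^ N. (q ^ l) ^ m)"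
      by simp
    then have "(\<Sum>j<l. (q ^ (p ^ N)) ^ j) / (1 - q ^ l) = (\<Sum>m<p ^ N. (q ^ l) ^ m) / (1 - q ^ (p ^ N))"
      using n by (subst frac_eq_eq) (simp_all only: mult.commute not_False_eq_True)
    then have "(1 - q) * ((\<Sum>j<l. (q ^ (p ^ N)) ^ j) / (1 - q ^ l))
        = (1 - q) * ((\<Sum>m<p ^ N. (q ^ l) ^ m) / (1 - q ^ (p ^ N)))"
      by (rule arg_cong)
    then show ?thesis by (simp add: qbracket_of_nat del: of_nat_power)
  qed
  ultimately show ?thesis using False by (simp add: q_quotient_def qbracket_of_nat mult.commute)
qed

lemma lim_riemann_sum_exponentials:
  assumes "\<And>m. g (of_nat m) = (\<Sum>l\<le>n. c l * (qpow q (- of_nat m) * qpow q (of_nat m) ^ l))"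
  shows "q_riemann_sum p q g \<longlonglongrightarrow> (\<Sum>l\<le>n. c l * q_quotient q 1 l)"
proof -
  have "(\<lambda>N. \<Sum>l\<le>n. c l * (1 / qbracket q (of_nat (p ^ N)) * (\<Sum>m<p ^ N. (q ^ l) ^ m)))
      \<longlonglongrightarrow> (\<Sum>l\<le>n. c l * q_quotient q 1 l)"
    by (intro lim_sum lim_cmult lim_geometric_riemann_sum)
  moreover have "(\<Sum>l\<le>n. c l * (1 / qbracket q (of_nat (p ^ N)) * (\<Sum>m<p ^ N. (q ^ l) ^ m)))
      = q_riemann_sum p q g N" for N
  proof -
    have g: "g (of_nat m) * qpow q (of_nat m) = (\<Sum>l\<le>n. c l * (q ^ l) ^ m)" for m
    proof -
      have "g (of_nat m) * qpow q (of_nat m)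
          = (\<Sum>l\<le>n. c l * ((qpow q (- of_nat m) * qpow q (of_nat m)) * qpow q (of_nat m) ^ l))"
        unfolding assms sum_distrib_right by (rule sum.cong) (auto simp: mult_ac)
      also have "\<dots> = (\<Sum>l\<le>n. c l * qpow q (of_nat m) ^ l)"
        by (simp add: qpow_minus near_1 padic_ints_of_nat)
      finally show ?thesis by (simp add: qpow_of_nat mult.commute flip: power_mult)
    qed
    have "q_riemann_sum p q g N = 1 / qbracket q (of_nat (p ^ N)) * (\<Sum>m<p ^ N. \<Sum>l\<le>n. c l * (q ^ l) ^ m)"
      unfolding q_riemann_sum_def g ..
    also have "(\<Sum>m<p ^ N. \<Sum>l\<le>n. c l * (q ^ l) ^ m) = (\<Sum>l\<le>n. c l * (\<Sum>m<p ^ N. (q ^ l) ^ m))"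
      unfolding sum_distrib_left by (rule sum.swap)
    finally show ?thesis by (simp add: sum_distrib_left mult_ac)
  qed
  ultimately show ?thesis by simp
qed

text \<open>Fixing the outermost variable \<open>y\<close> turns a combination of exponentials of
  \<open>s + y\<close> into one of exponentials of \<open>s\<close>, whose coefficients are again exponentials
  of \<open>y\<close>. Hence the coefficients have to be arbitrary for the induction on the number of
  integrals, and each integration multiplies the term of index \<open>l\<close> by the same moment.\<close>

lemma iter_q_integral_exponentials:
  assumes "\<And>ys. length ys = r \<Longrightarrow> set ys \<subseteq> padic_ints absp \<Longrightarrow>
    g ys = (\<Sum>l\<le>n. c l * (qpow q (- sum_list ys) * qpow q (sum_list ys) ^ l))"
  shows "iter_q_integrable p absp q r g \<and>
    iter_q_integral p q r g = (\<Sum>l\<le>n. c l * q_quotient q 1 l ^ r)"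
  using assms
proof (induction r arbitrary: g c)
  case 0
  then show ?case by simp
next
  case (Suc r)
  define d where "d y l = c l * (qpow q (- y) * qpow q y ^ l)" for y l
  have inner: "iter_q_integrable p absp q r (\<lambda>ys. g (ys @ [y])) \<and>
      iter_q_integral p q r (\<lambda>ys. g (ys @ [y])) = (\<Sum>l\<le>n. d y l * q_quotient q 1 l ^ r)"
    if y: "y \<in> padic_ints absp" for y
  proof (rule Suc.IH)
    fix ys :: "'a list" assume ys: "length ys = r" "set ys \<subseteq> padic_ints absp"
    then have s: "sum_list ys \<in> padic_ints absp" by (intro padic_ints_sum_list)
    have "qpow q (- (sum_list ys + y)) = qpow q (- sum_list ys) * qpow q (- y)"
      using qpow_add[OF near_1 padic_ints_minus[OF s] padic_ints_minus[OF y]] by simp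
    then show "g (ys @ [y]) = (\<Sum>l\<le>n. d y l * (qpow q (- sum_list ys) * qpow q (sum_list ys) ^ l))"
      using ys y s by (subst Suc.prems)
        (auto simp: d_def qpow_add near_1 power_mult_distrib mult_ac)
  qed
  have "q_riemann_sum p q (\<lambda>y. iter_q_integral p q r (\<lambda>ys. g (ys @ [y])))
      \<longlonglongrightarrow> (\<Sum>l\<le>n. (c l * q_quotient q 1 l ^ r) * q_quotient q 1 l)"
    by (rule lim_riemann_sum_exponentials)
       (simp add: inner padic_ints_of_nat d_def mult_ac)
  then show ?case
    using inner by (auto simp: q_integrable_def q_integral_def convergent_def mult_ac limI)
qed


section \<open>Explicit formula and distribution relation\<close>

lemma q_bernoulli_integrand_expand:
  assumes "x \<in> padic_ints absp" "set ys \<subseteq> padic_ints absp"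
  shows "q_bernoulli_integrand n q x ys = (\<Sum>l\<le>n. (of_nat (n choose l) * (-1) ^ l * qpow q x ^ l / (1 - q) ^ n) *
    (qpow q (- sum_list ys) * qpow q (sum_list ys) ^ l))"
proof -
  have s: "sum_list ys \<in> padic_ints absp" using assms(2) by (rule padic_ints_sum_list)
  have "(1 - qpow q (x + sum_list ys)) ^ n = (- (qpow q x * qpow q (sum_list ys)) + 1) ^ n"
    by (simp add: qpow_add near_1 assms s)
  also have "\<dots> = (\<Sum>l\<le>n. of_nat (n choose l) * (-1) ^ l * qpow q x ^ l * qpow q (sum_list ys) ^ l)"
    unfolding binomial_ring
    by (rule sum.cong) (auto simp: power_mult_distrib power_minus[of "_ * _"] mult_ac)
  finally show ?thesis
    by (simp add: q_bernoulli_integrand_def qbracket_def power_divide sum_distrib_left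
        sum_divide_distrib mult_ac)
qed

lemma q_bernoulli_explicit:
  assumes "x \<in> padic_ints absp"
  shows "iter_q_integrable p absp q r (q_bernoulli_integrand n q x)"
    and "q_bernoulli p r n q x =
      1 / (1 - q) ^ n * (\<Sum>l\<le>n. of_nat (n choose l) * (-1) ^ l * qpow q x ^ l * q_quotient q 1 l ^ r)"
proof -
  note * = iter_q_integral_exponentials[of r, OF q_bernoulli_integrand_expand[OF assms]]
  from * show "iter_q_integrable p absp q r (q_bernoulli_integrand n q x)" by blast
  from * show "q_bernoulli p r n q x =
      1 / (1 - q) ^ n * (\<Sum>l\<le>n. of_nat (n choose l) * (-1) ^ l * qpow q x ^ l * q_quotient q 1 l ^ r)"
    by (simp add: q_bernoulli_def sum_distrib_left)
qed

text \<open>At \<open>l = 0\<close> the geometric sum is \<open>f\<close> and cancels the \<open>f\<close> in the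
  limiting value of the quotient.\<close>

lemma geometric_sum_mult_q_quotient:
  assumes "f > 0"
  shows "(\<Sum>a<f. (q ^ l) ^ a) * q_quotient q f l = q_quotient q 1 l"
proof (cases "l = 0")
  case True
  then show ?thesis using assms by (simp add: q_quotient_def)
next
  case False
  have n: "1 - q ^ l \<noteq> 0" "1 - q ^ (l * f) \<noteq> 0" using one_minus_power_nonzero False assms by auto
  have "(1 - q ^ l) * (\<Sum>a<f. (q ^ l) ^ a) = 1 - q ^ (l * f)"
    by (simp add: power_mult one_diff_power_eq)
  then have "(\<Sum>a<f. (q ^ l) ^ a) = (1 - q ^ (l * f)) / (1 - q ^ l)"
    using n by (simp add: nonzero_eq_divide_eq mult.commute)
  then show ?thesis using False n unfolding q_quotient_def
    by (simp add: qbracket_of_nat del: of_nat_mult)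
qed

text \<open>This is the change of base behind the distribution relation; at \<open>l = 0\<close> it
  amounts to \<open>log (q\<^sup>f) = f log q\<close>.\<close>

lemma q_quotient_power_base:
  assumes "f > 0"
  shows "q_quotient (q ^ f) 1 l = qbracket q (of_nat f) * q_quotient q f l"
proof (cases "l = 0")
  case True
  have "q ^ f - 1 = (1 - q ^ f) / (1 - q) * (q - 1)"
    using one_minus_nonzero by (simp add: field_simps)
  then show ?thesis using True
    by (simp add: q_quotient_def padic_log_power near_1 qbracket_of_nat)
next
  case False
  then show ?thesis using one_minus_nonzero unfolding q_quotient_def
    by (simp add: qbracket_of_nat del: of_nat_mult)
       (simp add: qbracket_def qpow_of_nat mult.commute flip: power_mult)
qed

lemma padic_q_power:
  assumes "f > 0"
  shows "padic_q p absp (q ^ f)"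
proof unfold_locales
  show "absp (1 - q ^ f) < 1" using absp_power_minus_1_le[of q f] near_1 by linarith
  show "(q ^ f) ^ m \<noteq> 1" if "m > 0" for m
    using not_unity[of "f * m"] assms that by (simp add: power_mult)
qed

end

text \<open>Expanding the power of a sum of \<open>f\<close> terms gives one product for each index tuple.\<close>

lemma sum_index_tuples_power:
  fixes w :: "'a :: comm_semiring_1"
  shows "(\<Sum>as\<in>index_tuples f r. w ^ sum_list as) = (\<Sum>a<f. w ^ a) ^ r"
proof (induction r)
  case 0
  have "index_tuples f 0 = {[]}" by (auto simp: index_tuples_def)
  then show ?case by simp
next
  case (Suc r)
  have eq: "index_tuples f (Suc r) = (\<lambda>(as, a). a # as) ` (index_tuples f r \<times> {..<f})"
    using lists_length_Suc_eq[of "{..<f}" r] by (simp add: index_tuples_def conj_commute)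
  have "(\<Sum>as\<in>index_tuples f (Suc r). w ^ sum_list as)
      = (\<Sum>(as, a)\<in>index_tuples f r \<times> {..<f}. w ^ sum_list as * w ^ a)"
    unfolding eq by (subst sum.reindex)
      (auto simp: inj_on_def power_add mult.commute intro!: sum.cong)
  also have "\<dots> = (\<Sum>as\<in>index_tuples f r. w ^ sum_list as) * (\<Sum>a<f. w ^ a)"
    unfolding sum_product by (rule sum.cartesian_product[symmetric])
  finally show ?case using Suc by (simp add: mult.commute)
qed

lemma (in padic_q) explicit_sum_index_tuples:
  assumes x: "x \<in> padic_ints absp" and f: "f > 0"
  shows "(\<Sum>as\<in>index_tuples f r. qpow q (of_nat l * (of_nat (sum_list as) + x)) * q_quotient q f l ^ r)
    = qpow q x ^ l * q_quotient q 1 l ^ r"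
proof -
  have "qpow q (of_nat l * (of_nat (sum_list as) + x)) = (q ^ l) ^ sum_list as * qpow q x ^ l" for as
    by (simp only: qpow_of_nat_mult[OF near_1 padic_ints_add[OF padic_ints_of_nat x]]
        qpow_add[OF near_1 padic_ints_of_nat x] qpow_of_nat power_mult_distrib)
       (simp add: mult.commute flip: power_mult)
  then have "(\<Sum>as\<in>index_tuples f r. qpow q (of_nat l * (of_nat (sum_list as) + x)) * q_quotient q f l ^ r)
      = (\<Sum>as\<in>index_tuples f r. (q ^ l) ^ sum_list as) * (qpow q x ^ l * q_quotient q f l ^ r)"
    by (simp only: sum_distrib_right mult.assoc)
  also have "\<dots> = qpow q x ^ l * ((\<Sum>a<f. (q ^ l) ^ a) * q_quotient q f l) ^ r"
    by (simp add: sum_index_tuples_power power_mult_distrib mult_ac)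
  finally show ?thesis by (simp add: geometric_sum_mult_q_quotient f)
qed

lemma (in padic_q) q_bernoulli_tuple_formula:
  assumes "x \<in> padic_ints absp" "f > 0"
  shows "q_bernoulli p r n q x = 1 / (1 - q) ^ n *
    (\<Sum>l\<le>n. \<Sum>as\<in>index_tuples f r.
       of_nat (n choose l) * (-1) ^ l * qpow q (of_nat l * (of_nat (sum_list as) + x)) *
       q_quotient q f l ^ r)"
proof -
  have "(\<Sum>as\<in>index_tuples f r.
       of_nat (n choose l) * (-1) ^ l * qpow q (of_nat l * (of_nat (sum_list as) + x)) *
       q_quotient q f l ^ r) = of_nat (n choose l) * (-1) ^ l * qpow q x ^ l * q_quotient q 1 l ^ r" for l
    using explicit_sum_index_tuples[OF assms, where r = r and l = l] by (simp only: mult.assoc flip: sum_distrib_left)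
  then show ?thesis using q_bernoulli_explicit(2)[OF assms(1), of r n] by simp
qed

lemma (in padic_q) q_bernoulli_distribution:
  assumes x: "x \<in> padic_ints absp" and f: "f > 0" "coprime f p"
  shows "q_bernoulli p r n q x = qbracket q (of_nat f) powi (int n - int r) *
    (\<Sum>as\<in>index_tuples f r. q_bernoulli p r n (q ^ f) ((of_nat (sum_list as) + x) / of_nat f))"
proof -
  interpret qf: padic_q p absp "q ^ f" using f(1) by (rule padic_q_power)
  define B where "B = qbracket q (of_nat f)"
  have B: "B = (1 - q ^ f) / (1 - q)" by (simp add: B_def qbracket_of_nat)
  have n: "1 - q ^ f \<noteq> 0" "1 - q \<noteq> 0" using one_minus_power_nonzero[OF f(1)] one_minus_nonzero by auto
  then have B0: "B \<noteq> 0" by (simp add: B)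
  (* The r quotients for the base q ^ f contribute the factor B ^ r. *)
  have tuple: "q_bernoulli p r n (q ^ f) ((of_nat (sum_list as) + x) / of_nat f)
      = B ^ r / (1 - q ^ f) ^ n * (\<Sum>l\<le>n. of_nat (n choose l) * (-1) ^ l *
          qpow q (of_nat l * (of_nat (sum_list as) + x)) * q_quotient q f l ^ r)" for as
  proof -
    let ?y = "of_nat (sum_list as) + x"
    have y: "?y \<in> padic_ints absp" by (intro padic_ints_add padic_ints_of_nat x)
    then have y': "?y / of_nat f \<in> padic_ints absp" using f(2) by (rule padic_ints_divide)
    have "qpow (q ^ f) (?y / of_nat f) ^ l = qpow q (of_nat l * ?y)" for l
      using f(1) by (simp add: qpow_power_base near_1 y' qpow_of_nat_mult y)
    then show ?thesis
      unfolding qf.q_bernoulli_explicit(2)[OF y'] q_quotient_power_base[OF f(1)] B_def[symmetric]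
      by (simp add: power_mult_distrib sum_distrib_left mult_ac)
  qed
  have "(\<Sum>as\<in>index_tuples f r. q_bernoulli p r n (q ^ f) ((of_nat (sum_list as) + x) / of_nat f))
      = B ^ r / (1 - q ^ f) ^ n * (\<Sum>l\<le>n. \<Sum>as\<in>index_tuples f r. of_nat (n choose l) * (-1) ^ l *
          qpow q (of_nat l * (of_nat (sum_list as) + x)) * q_quotient q f l ^ r)"
    unfolding tuple sum_distrib_left[symmetric] by (subst sum.swap) (rule refl)
  also have "\<dots> = B ^ r / (1 - q ^ f) ^ n * ((1 - q) ^ n * q_bernoulli p r n q x)"
    using n unfolding q_bernoulli_tuple_formula[OF x f(1)] by simp
  also have "B powi (int n - int r) * \<dots> = q_bernoulli p r n q x"
  proof -
    have "B powi (int n - int r) = B ^ n / B ^ r" using B0 by (simp add: power_int_diff)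
    then show ?thesis using n B0 by (simp add: B power_divide field_simps)
  qed
  finally show ?thesis by (simp add: B_def)
qed

theorem theorem2:
  fixes p :: nat and absp :: "'a::{field_char_0,complete_space} \<Rightarrow> real"
    and q x :: 'a and r n f :: nat
  assumes "padic_complex p absp"
    and "absp (1 - q) < 1"
    and "\<forall>m>0. q ^ m \<noteq> 1"
    and "x \<in> padic_ints absp"
    and "f > 0" and "coprime f p"
  shows "iter_q_integrable p absp q r (q_bernoulli_integrand n q x)
    \<and> q_bernoulli p r n q x =
        1 / (1 - q) ^ n *
        (\<Sum>l\<le>n. \<Sum>as\<in>index_tuples f r.
           of_nat (n choose l) * (-1) ^ l * qpow q (of_nat l * (of_nat (sum_list as) + x)) *
           q_quotient q f l ^ r)
    \<and> q_bernoulli p r n q x =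
        qbracket q (of_nat f) powi (int n - int r) *
        (\<Sum>as\<in>index_tuples f r. q_bernoulli p r n (q ^ f) ((of_nat (sum_list as) + x) / of_nat f))"
proof -
  interpret padic_q p absp q
    using assms(1-3) by (simp add: padic_q_def padic_q_axioms_def)
  show ?thesis
    by (intro conjI q_bernoulli_explicit(1) q_bernoulli_tuple_formula q_bernoulli_distribution assms(4-6))
qed

end
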